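(* Let $V$ be a finite set of agents with $|V|=n$, $A$ a set of alternatives, $a,b$ two distinct elements of $A$, $\mathcal W\subseteq\mathcal W(A)$ and $\mathcal P=\mathcal W^V$. Assume that the set $\{W\in\mathcal W: a\sim_W b\}$ is finite, with elements enumerated without repetition as $W_1,\dots,W_\tau$ ($\tau\ge 0$). Let $L=\{0,1,\dots,n\}^{\tau+1}$ be endowed with the partial order $\le_L$ defined below, and let $\chi:\mathcal P\to L$ be $\chi(P)=\big(|D(a,P)|,|I_1(P)|,\dots,|I_\tau(P)|\big)$. Then there is a bijection $\Delta\mapsto\phi_\Delta$ from the set of all antichains $\Delta$ of the poset $\big(\chi(\mathcal P),\le_L\big)$ onto the set of all anonymous, weakly group strategy-proof social choice functions from $\mathcal P$ to $\{a,b\}$, where, for an antichain $\Delta$, the function $\phi_\Delta$ is defined by $$\phi_\Delta(P)=\begin{cases} a,&\text{if there is }(x_0,x_1,\dots,x_\tau)\in\Delta\text{ with }\big(|D(a,P)|,|I_1(P)|,\dots,|I_\tau(P)|\big)\ge_L(x_0,x_1,\dots,x_\tau),\\ b,&\text{otherwise.}\end{cases}$$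
   Context: $\mathcal W(A)$ is the set of all complete, transitive binary relations (preferences) on $A$. For $W\in\mathcal W(A)$: $x\succsim_W y$ means $(x,y)\in W$; $x\succ_W y$ means $(x,y)\in W$ and $(y,x)\notin W$; $x\sim_W y$ means both $(x,y),(y,x)\in W$. The elements of $\mathcal P=\mathcal W^V$ are the feasible profiles $P=(P_v)_{v\in V}$. $A$ need not be finite. $D(a,P)=\{v\in V: a\succ_{P_v} b\}$ and $I_i(P)=\{v\in V: P_v=W_i\}$ for $i=1,\dots,\tau$. The partial order on $L=\{0,1,\dots,n\}^{\tau+1}$ is: for $k=(k_0,\dots,k_\tau)$ and $\ell=(\ell_0,\dots,\ell_\tau)$, $k\le_L\ell$ iff $\sum_{i=1}^\tau (k_i-\ell_i)^+\le \ell_0-k_0$, where $t^+=\max\{t,0\}$. $\chi(\mathcal P)$ is the image of $\chi$, with the restricted order. An antichain of a poset is a subset in which no two distinct elements are comparable (the empty set is an antichain). A social choice function $\phi:\mathcal P\to A$ is weakly group strategy-proof if there are no nonempty $D\subseteq V$ and $P,Q\in\mathcal P$ such that $P_v=Q_v$ for all $v\in V\setminus D$ and $\phi(Q)\succ_{P_v}\phi(P)$ for all $v\in D$. It is anonymous if $\phi(P)=\phi(P\circ\sigma)$ for every $P\in\mathcal P$ and every permutation $\sigma$ of $V$, where $P\circ\sigma$ is the profile in which the preference of agent $v$ is $P_{\sigma(v)}$. *)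

theory Defs
  imports "HOL-Library.FuncSet" "HOL-Combinatorics.Permutations"
begin

text \<open>Completeness is required for all pairs, including \<open>x = y\<close>, hence it contains reflexivity.\<close>

definition preferences :: "'a set \<Rightarrow> 'a rel set" where
  "preferences A =
     {W. W \<subseteq> A \<times> A \<and> (\<forall>x\<in>A. \<forall>y\<in>A. (x, y) \<in> W \<or> (y, x) \<in> W) \<and> trans W}"

definition strictly_prefers :: "'a rel \<Rightarrow> 'a \<Rightarrow> 'a \<Rightarrow> bool" where
  "strictly_prefers W x y \<longleftrightarrow> (x, y) \<in> W \<and> (y, x) \<notin> W"

definition indifferent :: "'a rel \<Rightarrow> 'a \<Rightarrow> 'a \<Rightarrow> bool" where
  "indifferent W x y \<longleftrightarrow> (x, y) \<in> W \<and> (y, x) \<in> W"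

text \<open>Functions with a restricted domain (profiles, social choice functions, tuples) are
  represented extensionally, so that equality of functions is equality on the domain.\<close>

definition profiles :: "'v set \<Rightarrow> 'a rel set \<Rightarrow> ('v \<Rightarrow> 'a rel) set" where
  "profiles V \<W> = V \<rightarrow>\<^sub>E \<W>"

definition weakly_group_strategy_proof ::
    "'v set \<Rightarrow> 'a rel set \<Rightarrow> (('v \<Rightarrow> 'a rel) \<Rightarrow> 'a) \<Rightarrow> bool" where
  "weakly_group_strategy_proof V \<W> \<phi> \<longleftrightarrow>
     \<not> (\<exists>D P Q. D \<noteq> {} \<and> D \<subseteq> V \<and> P \<in> profiles V \<W> \<and> Q \<in> profiles V \<W> \<and>
          (\<forall>v\<in>V - D. P v = Q v) \<and> (\<forall>v\<in>D. strictly_prefers (P v) (\<phi> Q) (\<phi> P)))"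

text \<open>A permutation of \<open>V\<close> is the identity outside \<open>V\<close>, so \<open>P \<circ> \<sigma>\<close> is again extensional.\<close>

definition anonymous :: "'v set \<Rightarrow> 'a rel set \<Rightarrow> (('v \<Rightarrow> 'a rel) \<Rightarrow> 'a) \<Rightarrow> bool" where
  "anonymous V \<W> \<phi> \<longleftrightarrow>
     (\<forall>P\<in>profiles V \<W>. \<forall>\<sigma>. \<sigma> permutes V \<longrightarrow> \<phi> P = \<phi> (P \<circ> \<sigma>))"

text \<open>The set \<open>D(a, P)\<close>; the second alternative \<open>b\<close> is an explicit argument.\<close>

definition supporters :: "'v set \<Rightarrow> 'a \<Rightarrow> 'a \<Rightarrow> ('v \<Rightarrow> 'a rel) \<Rightarrow> 'v set" where
  "supporters V a b P = {v \<in> V. strictly_prefers (P v) a b}"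

definition agents_with :: "'v set \<Rightarrow> 'a rel \<Rightarrow> ('v \<Rightarrow> 'a rel) \<Rightarrow> 'v set" where
  "agents_with V W P = {v \<in> V. P v = W}"

definition L :: "nat \<Rightarrow> nat \<Rightarrow> (nat \<Rightarrow> nat) set" where
  "L n \<tau> = {0..\<tau>} \<rightarrow>\<^sub>E {0..n}"

definition L_order :: "nat \<Rightarrow> nat \<Rightarrow> (nat \<Rightarrow> nat) rel" where
  "L_order n \<tau> =
     {(k, l). k \<in> L n \<tau> \<and> l \<in> L n \<tau> \<and>
        (\<Sum>i=1..\<tau>. max (int (k i) - int (l i)) 0) \<le> int (l 0) - int (k 0)}"

text \<open>The relations \<open>W\<^sub>1, \<dots>, W\<^sub>\<tau>\<close> are given as a function \<open>W\<close> of which only the values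
  on \<open>{1..\<tau>}\<close> matter.\<close>

definition \<chi> ::
    "'v set \<Rightarrow> 'a \<Rightarrow> 'a \<Rightarrow> nat \<Rightarrow> (nat \<Rightarrow> 'a rel) \<Rightarrow> ('v \<Rightarrow> 'a rel) \<Rightarrow> nat \<Rightarrow> nat" where
  "\<chi> V a b \<tau> W P =
     (\<lambda>i\<in>{0..\<tau>}. if i = 0 then card (supporters V a b P) else card (agents_with V (W i) P))"

definition antichains :: "'b set \<Rightarrow> 'b rel \<Rightarrow> 'b set set" where
  "antichains S r =
     {\<Delta>. \<Delta> \<subseteq> S \<and> (\<forall>x\<in>\<Delta>. \<forall>y\<in>\<Delta>. x \<noteq> y \<longrightarrow> (x, y) \<notin> r \<and> (y, x) \<notin> r)}"

definition \<phi>_antichain ::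
    "'v set \<Rightarrow> 'a rel set \<Rightarrow> 'a \<Rightarrow> 'a \<Rightarrow> nat \<Rightarrow> (nat \<Rightarrow> 'a rel) \<Rightarrow> (nat \<Rightarrow> nat) set
      \<Rightarrow> ('v \<Rightarrow> 'a rel) \<Rightarrow> 'a" where
  "\<phi>_antichain V \<W> a b \<tau> W \<Delta> =
     (\<lambda>P\<in>profiles V \<W>.
        if \<exists>x\<in>\<Delta>. (x, \<chi> V a b \<tau> W P) \<in> L_order (card V) \<tau> then a else b)"

lemma partial_order_L: "partial_order_on (L n \<tau>) (L_order n \<tau>)"
proof -
  have tr: "(k, m) \<in> L_order n \<tau>"
    if "(k, l) \<in> L_order n \<tau>" "(l, m) \<in> L_order n \<tau>" for k l m
  proof -
    have "(\<Sum>i=1..\<tau>. max (int (k i) - int (m i)) 0)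
        \<le> (\<Sum>i=1..\<tau>. max (int (k i) - int (l i)) 0 + max (int (l i) - int (m i)) 0)"
      by (rule sum_mono) auto
    then show ?thesis using that by (auto simp: L_order_def sum.distrib)
  qed
  have as: "k = l" if kl: "(k, l) \<in> L_order n \<tau>" and lk: "(l, k) \<in> L_order n \<tau>" for k l
  proof -
    let ?s = "\<lambda>k l. \<Sum>i=1..\<tau>. max (int (k i) - int (l i)) 0"
    have nn: "0 \<le> ?s k l" "0 \<le> ?s l k" by (auto intro: sum_nonneg)
    have le: "?s k l \<le> int (l 0) - int (k 0)" "?s l k \<le> int (k 0) - int (l 0)"
      using kl lk by (auto simp: L_order_def)
    have z: "k 0 = l 0" and s: "?s k l = 0" "?s l k = 0" using nn le by linarith+
    have i: "k i = l i" if "i \<in> {1..\<tau>}" for i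
    proof -
      have "max (int (k i) - int (l i)) 0 = 0" "max (int (l i) - int (k i)) 0 = 0"
        using s that by (simp_all add: sum_nonneg_eq_0_iff)
      then show ?thesis by linarith
    qed
    have "k i = l i" if "i \<in> {0..\<tau>}" for i
      using z i that by (cases i) auto
    moreover have "k \<in> {0..\<tau>} \<rightarrow>\<^sub>E {0..n}" "l \<in> {0..\<tau>} \<rightarrow>\<^sub>E {0..n}"
      using kl by (auto simp: L_order_def L_def)
    ultimately show ?thesis by (meson PiE_ext)
  qed
  show ?thesis
    unfolding partial_order_on_def preorder_on_def
  proof (intro conjI)
    show "L_order n \<tau> \<subseteq> L n \<tau> \<times> L n \<tau>" by (auto simp: L_order_def)
    show "refl_on (L n \<tau>) (L_order n \<tau>)" by (auto simp: refl_on_def L_order_def)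
    show "trans (L_order n \<tau>)" using tr by (rule transI)
    show "antisym (L_order n \<tau>)" using as by (rule antisymI)
  qed
qed

lemma \<chi>_in_L: "finite V \<Longrightarrow> \<chi> V a b \<tau> W P \<in> L (card V) \<tau>"
  by (auto simp: \<chi>_def L_def supporters_def agents_with_def intro!: card_mono)

end

theory Submission
  imports Defs
begin

text \<open>
  Say that a profile \<open>Q\<close> improves a profile \<open>P\<close> for \<open>a\<close> if every agent whose preference changes
  strictly prefers \<open>b\<close> in \<open>P\<close> or strictly prefers \<open>a\<close> in \<open>Q\<close>. Weak group strategy-proofness of a
  two-valued function means that the value \<open>a\<close> is kept under improvements: first change the agents
  who prefer \<open>b\<close>, then those who come to prefer \<open>a\<close>. Moreover \<open>\<chi> P \<le> \<chi> Q\<close> holds iff \<open>Q\<close>, after a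
  permutation of the agents, improves \<open>P\<close>: the sum of the \<open>(k\<^sub>i - l\<^sub>i)\<^sup>+\<close> counts the agents indifferent
  in \<open>P\<close> who cannot keep their preference and therefore have to be matched with supporters of \<open>a\<close>
  in \<open>Q\<close>. So the functions in question correspond to the up-sets of the finite poset of values of
  \<open>\<chi>\<close>, and these are determined by their antichains of minimal elements.
\<close>

section \<open>Antichains and up-sets of a finite poset\<close>

text \<open>The inverse map takes an up-set to its minimal elements; since \<open>S\<close> is
  finite, every element of an up-set lies above a minimal one.\<close>

lemma bij_betw_antichains_up_sets:
  assumes "finite S" "S \<subseteq> T" "partial_order_on T r"
  shows "bij_betw (\<lambda>\<Delta>. {x \<in> S. \<exists>y\<in>\<Delta>. (y, x) \<in> r}) (antichains S r)
    {U. U \<subseteq> S \<and> (\<forall>x\<in>U. \<forall>y\<in>S. (x, y) \<in> r \<longrightarrow> y \<in> U)}"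
    (is "bij_betw ?up _ ?Us")
proof -
  have refl: "(x, x) \<in> r" if "x \<in> S" for x
    using assms that by (auto simp: partial_order_on_def preorder_on_def refl_on_def)
  have trans: "(x, z) \<in> r" if "(x, y) \<in> r" "(y, z) \<in> r" for x y z
    using assms(3) that by (auto simp: partial_order_on_def preorder_on_def dest: transD)
  have antisym: "x = y" if "(x, y) \<in> r" "(y, x) \<in> r" for x y
    using assms(3) that by (auto simp: partial_order_on_def dest: antisymD)
  define mins where "mins U = {x \<in> U. \<forall>y\<in>U. (y, x) \<in> r \<longrightarrow> y = x}" for U
  have ex_min: "\<exists>y\<in>mins U. (y, x) \<in> r" if U: "U \<subseteq> S" "x \<in> U" for U x
  proof -
    \<comment> \<open>Only \<open>S\<close> is known to be finite, so the strict order is cut down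
      to it.\<close>
    have wf: "wf ((r - Id) \<inter> S \<times> S)"
    proof (rule finite_acyclic_wf)
      show "finite ((r - Id) \<inter> S \<times> S)" using assms(1) by blast
      have "trans ((r - Id) \<inter> S \<times> S)"
        by (rule transI) (use trans antisym in blast)
      then show "acyclic ((r - Id) \<inter> S \<times> S)"
        by (simp add: acyclic_def)
    qed
    \<comment> \<open>Minimising among the elements below \<open>x\<close> still yields a minimal
      element of all of \<open>U\<close>: by transitivity, whatever lies below it lies below
      \<open>x\<close>.\<close>
    have "x \<in> {y \<in> U. (y, x) \<in> r}" using U refl by blast
    from wfE_min[OF wf this] obtain z
      where "z \<in> {y \<in> U. (y, x) \<in> r}"
        and "\<And>y. (y, z) \<in> (r - Id) \<inter> S \<times> S \<Longrightarrow> y \<notin> {y \<in> U. (y, x) \<in> r}"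
      by blast
    then have "z \<in> mins U" "(z, x) \<in> r"
      unfolding mins_def using U trans by blast+
    then show ?thesis by blast
  qed
  show ?thesis
  proof (rule bij_betw_byWitness[where f' = mins])
    show "\<forall>\<Delta>\<in>antichains S r. mins (?up \<Delta>) = \<Delta>"
    proof
      fix \<Delta> assume "\<Delta> \<in> antichains S r"
      then have "\<Delta> \<subseteq> S" and eq: "\<And>x y. x \<in> \<Delta> \<Longrightarrow> y \<in> \<Delta> \<Longrightarrow> (x, y) \<in> r \<Longrightarrow> x = y"
        by (auto simp: antichains_def)
      show "mins (?up \<Delta>) = \<Delta>"
      proof
        show "mins (?up \<Delta>) \<subseteq> \<Delta>"
          unfolding mins_def using \<open>\<Delta> \<subseteq> S\<close> refl by blast
        show "\<Delta> \<subseteq> mins (?up \<Delta>)"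
        proof
          fix x assume x: "x \<in> \<Delta>"
          \<comment> \<open>Such a \<open>y\<close> lies above some \<open>z\<close> of the
            antichain and is squeezed between \<open>z\<close> and \<open>x\<close>, which
            coincide.\<close>
          have "y = x" if "y \<in> ?up \<Delta>" "(y, x) \<in> r" for y
          proof -
            obtain z where z: "z \<in> \<Delta>" "(z, y) \<in> r" using \<open>y \<in> ?up \<Delta>\<close> by blast
            have "z = x" using eq[OF z(1) x] trans[OF z(2) \<open>(y, x) \<in> r\<close>] .
            then show ?thesis using antisym z that by blast
          qed
          then show "x \<in> mins (?up \<Delta>)"
            unfolding mins_def using x \<open>\<Delta> \<subseteq> S\<close> refl by blast
        qed
      qed
    qed
    show "\<forall>U\<in>?Us. ?up (mins U) = U"
    proof
      fix U assume U: "U \<in> ?Us"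
      have "?up (mins U) \<subseteq> U" using U unfolding mins_def by blast
      moreover have "U \<subseteq> ?up (mins U)" using U ex_min by blast
      ultimately show "?up (mins U) = U" by blast
    qed
    show "?up ` antichains S r \<subseteq> ?Us"
      using trans by blast
    show "mins ` ?Us \<subseteq> antichains S r"
      unfolding mins_def antichains_def by blast
  qed
qed

section \<open>Completing injections to permutations\<close>

text \<open>The complements in \<open>V\<close> of \<open>X\<close> and of its image have the same
  finite size, so any bijection between them completes \<open>g\<close>.\<close>

lemma extend_inj_on_to_permutation:
  assumes "finite V" "X \<subseteq> V" "inj_on g X" "g ` X \<subseteq> V"
  obtains \<sigma> where "\<sigma> permutes V" "\<And>x. x \<in> X \<Longrightarrow> \<sigma> x = g x"
proof -
  have "card (V - X) = card (V - g ` X)"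
    using assms by (simp add: card_Diff_subset finite_subset card_image)
  then obtain h where h: "bij_betw h (V - X) (V - g ` X)"
    using assms(1) by (meson finite_Diff finite_same_card_bij)
  define \<sigma> where "\<sigma> = (\<lambda>x. if x \<in> X then g x else if x \<in> V then h x else x)"
  have "bij_betw \<sigma> X (g ` X)"
    using assms(3) by (auto simp: bij_betw_def \<sigma>_def inj_on_def)
  moreover have "bij_betw \<sigma> (V - X) (V - g ` X)"
    using h by (subst bij_betw_cong[where g = h]) (auto simp: \<sigma>_def)
  ultimately have "bij_betw \<sigma> (X \<union> (V - X)) (g ` X \<union> (V - g ` X))"
    by (rule bij_betw_combine) blast
  moreover have "X \<union> (V - X) = V" "g ` X \<union> (V - g ` X) = V" using assms by auto
  ultimately have "bij_betw \<sigma> V V" by simp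
  then have "\<sigma> permutes V"
    by (rule bij_imp_permutes) (use assms(2) in \<open>auto simp: \<sigma>_def\<close>)
  then show ?thesis by (rule that) (simp add: \<sigma>_def)
qed

section \<open>Strategy-proofness as monotonicity under improvements\<close>

definition improves :: "'v set \<Rightarrow> 'a \<Rightarrow> 'a \<Rightarrow> ('v \<Rightarrow> 'a rel) \<Rightarrow> ('v \<Rightarrow> 'a rel) \<Rightarrow> bool" where
  "improves V a b P Q \<longleftrightarrow>
     (\<forall>v\<in>V. P v = Q v \<or> strictly_prefers (Q v) a b \<or> strictly_prefers (P v) b a)"

text \<open>For the converse direction, a manipulation is itself an improvement: of \<open>P\<close>
  by \<open>Q\<close> if it turns \<open>a\<close> into \<open>b\<close>, of \<open>Q\<close> by
  \<open>P\<close> if it turns \<open>b\<close> into \<open>a\<close>. Either way the value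
  \<open>a\<close> would be lost under an improvement.\<close>

lemma weakly_group_strategy_proof_iff_improves:
  assumes \<phi>: "\<phi> \<in> profiles V \<W> \<rightarrow> {a, b}" and "a \<noteq> b"
  shows "weakly_group_strategy_proof V \<W> \<phi> \<longleftrightarrow>
    (\<forall>P\<in>profiles V \<W>. \<forall>Q\<in>profiles V \<W>. improves V a b P Q \<longrightarrow> \<phi> P = a \<longrightarrow> \<phi> Q = a)"
    (is "_ \<longleftrightarrow> ?mono")
proof
  assume sp: "weakly_group_strategy_proof V \<W> \<phi>"
  \<comment> \<open>The coalition consists of all agents whose preference changes. It is nonempty
    because extensional profiles that differ do so inside \<open>V\<close>.\<close>
  have sp': "\<not> (\<forall>v\<in>V. P v = Q v \<or> strictly_prefers (P v) (\<phi> Q) (\<phi> P))"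
    if "P \<in> profiles V \<W>" "Q \<in> profiles V \<W>" "\<phi> P \<noteq> \<phi> Q" for P Q
  proof
    assume *: "\<forall>v\<in>V. P v = Q v \<or> strictly_prefers (P v) (\<phi> Q) (\<phi> P)"
    let ?D = "{v \<in> V. P v \<noteq> Q v}"
    have "P \<noteq> Q" using that by blast
    then have "?D \<noteq> {}"
      using that(1,2) PiE_ext[of P V "\<lambda>_. \<W>" Q] unfolding profiles_def by auto
    then have "\<not> weakly_group_strategy_proof V \<W> \<phi>"
      unfolding weakly_group_strategy_proof_def not_not
      by (intro exI[of _ ?D] exI[of _ P] exI[of _ Q]) (use * that(1,2) in auto)
    then show False using sp by blast
  qed
  show ?mono
  proof (intro ballI impI)
    fix P Q
    assume P: "P \<in> profiles V \<W>" and Q: "Q \<in> profiles V \<W>"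
      and imp: "improves V a b P Q" and a: "\<phi> P = a"
    \<comment> \<open>The intermediate profile: exactly those who strictly prefer \<open>b\<close>
      in \<open>P\<close> have moved to \<open>Q\<close>. If this made the value \<open>b\<close>,
      they would have manipulated at \<open>P\<close>.\<close>
    define R where "R = (\<lambda>v. if strictly_prefers (P v) b a then Q v else P v)"
    have R: "R \<in> profiles V \<W>"
      using P Q unfolding R_def profiles_def by (auto simp: PiE_iff extensional_def)
    have "\<phi> R = a"
    proof (rule ccontr)
      assume "\<phi> R \<noteq> a"
      then have "\<phi> R = b" using \<phi> R by blast
      then have "\<forall>v\<in>V. P v = R v \<or> strictly_prefers (P v) (\<phi> R) (\<phi> P)"
        using a by (simp add: R_def)
      then show False using sp'[OF P R] \<open>\<phi> R = b\<close> a \<open>a \<noteq> b\<close> by simp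
    qed
    show "\<phi> Q = a"
    proof (rule ccontr)
      assume "\<phi> Q \<noteq> a"
      then have "\<phi> Q = b" using \<phi> Q by blast
      \<comment> \<open>Here the true profile is \<open>Q\<close>: the agents who differ strictly
        prefer \<open>a\<close> there and would obtain it by reporting \<open>R\<close>.\<close>
      moreover have "\<forall>v\<in>V. Q v = R v \<or> strictly_prefers (Q v) a b"
        using imp unfolding R_def improves_def by metis
      ultimately show False using sp'[OF Q R] \<open>\<phi> R = a\<close> \<open>a \<noteq> b\<close> by simp
    qed
  qed
next
  assume mono: ?mono
  show "weakly_group_strategy_proof V \<W> \<phi>"
    unfolding weakly_group_strategy_proof_def
  proof (intro notI, elim exE conjE)
    fix D P Q
    assume D: "D \<noteq> {}" "D \<subseteq> V" and P: "P \<in> profiles V \<W>" and Q: "Q \<in> profiles V \<W>"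
      and out: "\<forall>v\<in>V - D. P v = Q v"
      and gain: "\<forall>v\<in>D. strictly_prefers (P v) (\<phi> Q) (\<phi> P)"
    have ne: "\<phi> P \<noteq> \<phi> Q" using D gain by (auto simp: strictly_prefers_def)
    consider "\<phi> P = a" "\<phi> Q = b" | "\<phi> P = b" "\<phi> Q = a"
      using funcset_mem[OF \<phi> P] funcset_mem[OF \<phi> Q] ne
      by (metis insertE singletonD)
    then show False
    proof cases
      case 1
      then have "improves V a b P Q" using out gain unfolding improves_def by (metis DiffI)
      then show False using mono P Q 1 \<open>a \<noteq> b\<close> by auto
    next
      case 2
      then have "improves V a b Q P" using out gain unfolding improves_def by (metis DiffI)
      then show False using mono P Q 2 \<open>a \<noteq> b\<close> by auto
    qed
  qed
qed

section \<open>Comparing profiles through their values of \<chi>\<close>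

lemma \<chi>_permute:
  assumes "\<sigma> permutes V"
  shows "\<chi> V a b \<tau> W (P \<circ> \<sigma>) = \<chi> V a b \<tau> W P"
proof -
  \<comment> \<open>The arbitrary property \<open>p\<close> covers both kinds of entries: support
    for \<open>a\<close> and equality with \<open>W i\<close>.\<close>
  have "card {v \<in> V. p (P (\<sigma> v))} = card {v \<in> V. p (P v)}" for p
  proof (rule bij_betw_same_card[where f = \<sigma>])
    have "\<sigma> ` {v \<in> V. p (P (\<sigma> v))} = {v \<in> V. p (P v)}"
    proof
      show "{v \<in> V. p (P v)} \<subseteq> \<sigma> ` {v \<in> V. p (P (\<sigma> v))}"
      proof
        fix v assume v: "v \<in> {v \<in> V. p (P v)}"
        then obtain u where "u \<in> V" "v = \<sigma> u" using permutes_image[OF assms] by blast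
        then show "v \<in> \<sigma> ` {v \<in> V. p (P (\<sigma> v))}" using v by blast
      qed
    qed (use permutes_in_image[OF assms] in auto)
    then show "bij_betw \<sigma> {v \<in> V. p (P (\<sigma> v))} {v \<in> V. p (P v)}"
      using permutes_inj_on[OF assms] by (auto simp: bij_betw_def)
  qed
  from this[of "\<lambda>w. strictly_prefers w a b"] this[of "\<lambda>w. w = W i" for i]
  show ?thesis
    by (auto simp: \<chi>_def supporters_def agents_with_def intro!: restrict_ext)
qed

locale two_alternatives =
  fixes V :: "'v set" and \<W> :: "'a rel set" and a b :: 'a
    and \<tau> :: nat and W :: "nat \<Rightarrow> 'a rel"
  assumes finite_V: "finite V"
    and a_neq_b: "a \<noteq> b"
    and complete: "w \<in> \<W> \<Longrightarrow> (a, b) \<in> w \<or> (b, a) \<in> w"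
    and bij_W: "bij_betw W {1..\<tau>} {w \<in> \<W>. indifferent w a b}"
begin

lemma W_indifferent: "i \<in> {1..\<tau>} \<Longrightarrow> indifferent (W i) a b"
  using bij_W by (auto simp: bij_betw_def)

lemma W_eq_iff: "i \<in> {1..\<tau>} \<Longrightarrow> j \<in> {1..\<tau>} \<Longrightarrow> W i = W j \<longleftrightarrow> i = j"
  by (rule inj_on_eq_iff[OF bij_betw_imp_inj_on[OF bij_W]])

lemma preference_cases:
  assumes "w \<in> \<W>"
  obtains "strictly_prefers w a b" | "strictly_prefers w b a" | i where "i \<in> {1..\<tau>}" "w = W i"
proof -
  have "w \<in> W ` {1..\<tau>}" if "indifferent w a b"
    using bij_W assms that by (auto simp: bij_betw_def)
  then show thesis
    using that complete[OF assms] unfolding strictly_prefers_def indifferent_def by blast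
qed

lemma finite_supporters: "finite (supporters V a b P)"
  and finite_agents_with: "finite (agents_with V w P)"
  using finite_V by (auto simp: supporters_def agents_with_def)

lemma agents_with_disjoint:
  "i \<in> {1..\<tau>} \<Longrightarrow> j \<in> {1..\<tau>} \<Longrightarrow> i \<noteq> j \<Longrightarrow> agents_with V (W i) P \<inter> agents_with V (W j) P = {}"
  using W_eq_iff by (auto simp: agents_with_def)

lemma agents_with_supporters_disjoint:
  "i \<in> {1..\<tau>} \<Longrightarrow> agents_with V (W i) P \<inter> supporters V a b P = {}"
  using W_indifferent
  by (fastforce simp: agents_with_def supporters_def strictly_prefers_def indifferent_def)

text \<open>Truncated subtraction on \<open>nat\<close> is the positive part in the order on
  \<open>L\<close>. In this form, the supporters of \<open>a\<close> in \<open>Q\<close> must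
  suffice for those in \<open>P\<close> and for the surplus of each \<open>W i\<close> in
  \<open>P\<close> over \<open>Q\<close>.\<close>

lemma \<chi>_le_iff:
  "(\<chi> V a b \<tau> W P, \<chi> V a b \<tau> W Q) \<in> L_order (card V) \<tau> \<longleftrightarrow>
    card (supporters V a b P) +
      (\<Sum>i=1..\<tau>. card (agents_with V (W i) P) - card (agents_with V (W i) Q))
    \<le> card (supporters V a b Q)"
proof -
  have "max (int k - int l) 0 = int (k - l)" for k l :: nat by simp
  then have "(\<Sum>i=1..\<tau>. max (int (\<chi> V a b \<tau> W P i) - int (\<chi> V a b \<tau> W Q i)) 0) =
      (\<Sum>i=1..\<tau>. int (card (agents_with V (W i) P) - card (agents_with V (W i) Q)))"
    by (intro sum.cong) (auto simp: \<chi>_def)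
  also have "\<dots> =
      int (\<Sum>i=1..\<tau>. card (agents_with V (W i) P) - card (agents_with V (W i) Q))"
    by simp
  finally have sum: "(\<Sum>i=1..\<tau>. max (int (\<chi> V a b \<tau> W P i) - int (\<chi> V a b \<tau> W Q i)) 0) =
      int (\<Sum>i=1..\<tau>. card (agents_with V (W i) P) - card (agents_with V (W i) Q))" .
  have "\<chi> V a b \<tau> W P 0 = card (supporters V a b P)" for P by (simp add: \<chi>_def)
  then show ?thesis
    using \<chi>_in_L[OF finite_V] unfolding L_order_def mem_Collect_eq prod.case sum
    by (auto simp del: of_nat_sum)
qed

text \<open>Supporters of \<open>a\<close> remain supporters, and an agent who gives up some
  \<open>W i\<close> becomes a new one. These agents differ for different \<open>i\<close>, so the
  number of new supporters bounds the sum.\<close>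

lemma \<chi>_le_if_improves:
  assumes imp: "improves V a b P Q"
  shows "(\<chi> V a b \<tau> W P, \<chi> V a b \<tau> W Q) \<in> L_order (card V) \<tau>"
proof -
  let ?A = "\<lambda>i. agents_with V (W i) P" and ?B = "\<lambda>i. agents_with V (W i) Q"
  let ?S = "supporters V a b P" and ?T = "supporters V a b Q"
  have sub: "?S \<subseteq> ?T"
    using imp by (fastforce simp: improves_def supporters_def strictly_prefers_def)
  have "?A i - ?B i \<subseteq> ?T - ?S" if "i \<in> {1..\<tau>}" for i
    using imp W_indifferent[OF that]
    by (fastforce simp: improves_def supporters_def agents_with_def strictly_prefers_def
        indifferent_def)
  then have UN: "(\<Union>i\<in>{1..\<tau>}. ?A i - ?B i) \<subseteq> ?T - ?S" by blast
  have "(\<Sum>i=1..\<tau>. card (?A i) - card (?B i)) \<le> (\<Sum>i=1..\<tau>. card (?A i - ?B i))"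
    by (intro sum_mono diff_card_le_card_Diff finite_agents_with)
  also have "\<dots> = card (\<Union>i\<in>{1..\<tau>}. ?A i - ?B i)"
    by (rule card_UN_disjoint[symmetric])
      (use agents_with_disjoint[of _ _ P] in \<open>blast intro: finite_agents_with finite_Diff\<close>)+
  also have "\<dots> \<le> card (?T - ?S)"
    using UN finite_supporters by (intro card_mono) auto
  also have "\<dots> = card ?T - card ?S"
    using sub by (simp add: card_Diff_subset finite_supporters)
  \<comment> \<open>As \<open>?S\<close> is contained in \<open>?T\<close>, the truncated difference
    of their sizes is exact.\<close>
  finally show ?thesis
    unfolding \<chi>_le_iff using card_mono[OF finite_supporters sub] by linarith
qed

text \<open>Agents in \<open>P\<close> are matched with places in \<open>Q\<close>: as many as
  possible keep each \<open>W i\<close>, while supporters of \<open>a\<close> and the remaining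
  indifferent agents go to supporters in \<open>Q\<close>. Those who strictly prefer
  \<open>b\<close> in \<open>P\<close> may take any place left.\<close>

lemma improves_permuted_if_\<chi>_le:
  assumes P: "P \<in> profiles V \<W>"
    and le: "(\<chi> V a b \<tau> W P, \<chi> V a b \<tau> W Q) \<in> L_order (card V) \<tau>"
  obtains \<sigma> where "\<sigma> permutes V" "improves V a b P (Q \<circ> \<sigma>)"
proof -
  let ?A = "\<lambda>i. agents_with V (W i) P" and ?B = "\<lambda>i. agents_with V (W i) Q"
  let ?S = "supporters V a b P" and ?T = "supporters V a b Q"
  have "\<exists>C \<subseteq> ?A i. card C = min (card (?A i)) (card (?B i))" for i
    by (meson min.cobounded1 obtain_subset_with_card_n)
  then obtain C where C: "\<And>i. C i \<subseteq> ?A i"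
    and card_C: "\<And>i. card (C i) = min (card (?A i)) (card (?B i))"
    by metis
  have fin_C: "finite (C i)" for i using C finite_agents_with finite_subset by blast
  have "\<exists>h. h ` C i \<subseteq> ?B i \<and> inj_on h (C i)" for i
    by (rule card_le_inj) (simp_all add: fin_C finite_agents_with card_C)
  then obtain h where h: "\<And>i. h i ` C i \<subseteq> ?B i" and inj_h: "\<And>i. inj_on (h i) (C i)"
    by metis
  define R where "R = (\<Union>i\<in>{1..\<tau>}. ?A i - C i)"
  have "card R = (\<Sum>i=1..\<tau>. card (?A i - C i))"
    unfolding R_def
    by (rule card_UN_disjoint)
      (use agents_with_disjoint[of _ _ P] in \<open>blast intro: finite_agents_with finite_Diff\<close>)+
  \<comment> \<open>Removing the \<open>min\<close> of two numbers from the first leaves their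
    truncated difference, so \<open>R\<close> has the size of the sum in
    \<open>\<chi>_le_iff\<close>.\<close>
  also have "\<dots> = (\<Sum>i=1..\<tau>. card (?A i) - card (?B i))"
    by (intro sum.cong) (auto simp: card_Diff_subset[OF fin_C C] card_C)
  finally have "card (?S \<union> R) \<le> card ?T"
    using le card_Un_le[of ?S R] unfolding \<chi>_le_iff by linarith
  moreover have "finite (?S \<union> R)"
    by (auto simp: R_def finite_agents_with finite_supporters)
  ultimately obtain r where r: "r ` (?S \<union> R) \<subseteq> ?T" and inj_r: "inj_on r (?S \<union> R)"
    using card_le_inj finite_supporters by meson
  define K where "K = (\<Union>i\<in>{1..\<tau>}. C i)"
  \<comment> \<open>The sets \<open>C i\<close> with \<open>i\<close> in \<open>{1..\<tau>}\<close>
    are disjoint, so an agent in \<open>K\<close> determines its index; this glues the maps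
    \<open>h i\<close> together.\<close>
  define ix where "ix v = (THE i. i \<in> {1..\<tau>} \<and> v \<in> C i)" for v
  have ix: "ix v = i" if "i \<in> {1..\<tau>}" "v \<in> C i" for v i
    unfolding ix_def
    by (rule the_equality) (use that C agents_with_disjoint[of _ _ P] in blast)+
  define g where "g v = (if v \<in> K then h (ix v) v else r v)" for v
  have g_C: "g v = h i v" if "i \<in> {1..\<tau>}" "v \<in> C i" for i v
    using that ix by (auto simp: g_def K_def)
  have disj: "K \<inter> (?S \<union> R) = {}"
  proof -
    have "K \<inter> ?S = {}"
      using C agents_with_supporters_disjoint[of _ P] unfolding K_def by blast
    moreover have "K \<inter> R = {}"
    proof (rule ccontr)
      assume "K \<inter> R \<noteq> {}"
      then obtain v i j where "i \<in> {1..\<tau>}" "j \<in> {1..\<tau>}" "v \<in> C i" "v \<in> ?A j" "v \<notin> C j"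
        unfolding K_def R_def by blast
      then show False using C agents_with_disjoint[of i j P] by blast
    qed
    ultimately show ?thesis by blast
  qed
  have g_R: "g v = r v" if "v \<in> ?S \<union> R" for v
    using that disj unfolding g_def by auto
  have g_K_B: "g v \<in> ?B i" if "i \<in> {1..\<tau>}" "v \<in> C i" for i v
    using g_C[OF that] h that by auto
  have g_R_T: "g v \<in> ?T" if "v \<in> ?S \<union> R" for v
    using g_R[OF that] r that by blast
  have inj_K: "inj_on g K"
  proof (rule inj_onI)
    fix u v assume "u \<in> K" "v \<in> K" and eq: "g u = g v"
    then obtain i j where i: "i \<in> {1..\<tau>}" "u \<in> C i" and j: "j \<in> {1..\<tau>}" "v \<in> C j"
      unfolding K_def by blast
    have "i = j"
      using g_K_B[OF i] g_K_B[OF j] eq agents_with_disjoint[OF i(1) j(1)] by auto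
    then show "u = v"
      using eq g_C[OF i] g_C[OF j] inj_onD[OF inj_h] i j by metis
  qed
  have inj: "inj_on g (K \<union> (?S \<union> R))"
  proof (rule inj_on_Un[THEN iffD2], intro conjI)
    show "inj_on g (?S \<union> R)" using inj_r g_R unfolding inj_on_def by metis
    \<comment> \<open>Agents in \<open>K\<close> are sent to indifferent agents of \<open>Q\<close>,
      the others to supporters of \<open>a\<close>.\<close>
    have "g u \<noteq> g v" if u: "u \<in> K" and v: "v \<in> ?S \<union> R" for u v
    proof -
      obtain i where i: "i \<in> {1..\<tau>}" "u \<in> C i" using u unfolding K_def by blast
      show ?thesis
        using g_K_B[OF i] g_R_T[OF v] agents_with_supporters_disjoint[OF i(1), of Q] by auto
    qed
    then show "g ` (K - (?S \<union> R)) \<inter> g ` (?S \<union> R - K) = {}" by blast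
  qed (rule inj_K)
  have A_V: "?A i \<subseteq> V" "?B i \<subseteq> V" for i by (auto simp: agents_with_def)
  have S_V: "?S \<subseteq> V" "?T \<subseteq> V" by (auto simp: supporters_def)
  have dom: "K \<union> (?S \<union> R) \<subseteq> V"
    using C A_V S_V unfolding K_def R_def by blast
  have "g ` K \<subseteq> V" using g_K_B A_V unfolding K_def by blast
  moreover have "g ` (?S \<union> R) \<subseteq> V" using g_R_T S_V by blast
  ultimately have "g ` (K \<union> (?S \<union> R)) \<subseteq> V" by blast
  with finite_V dom inj obtain \<sigma>
    where \<sigma>: "\<sigma> permutes V" and \<sigma>_g: "\<And>v. v \<in> K \<union> (?S \<union> R) \<Longrightarrow> \<sigma> v = g v"
    by (rule extend_inj_on_to_permutation) blast
  have keep: "Q (\<sigma> v) = W i" if "i \<in> {1..\<tau>}" "v \<in> C i" for i v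
  proof -
    have "\<sigma> v = g v" by (rule \<sigma>_g) (use that K_def in blast)
    then show ?thesis using g_K_B[OF that] by (simp add: agents_with_def)
  qed
  have supp: "strictly_prefers (Q (\<sigma> v)) a b" if "v \<in> ?S \<union> R" for v
    using \<sigma>_g[of v] g_R_T[OF that] that by (simp add: supporters_def)
  have "improves V a b P (Q \<circ> \<sigma>)"
    unfolding improves_def comp_def
  proof
    fix v assume v: "v \<in> V"
    then have "P v \<in> \<W>" using P by (auto simp: profiles_def)
    then show "P v = Q (\<sigma> v) \<or> strictly_prefers (Q (\<sigma> v)) a b \<or> strictly_prefers (P v) b a"
    proof (cases rule: preference_cases)
      case 1
      then show ?thesis using supp v by (auto simp: supporters_def)
    next
      case (3 i)
      then have "v \<in> ?A i" using v by (simp add: agents_with_def)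
      then have "v \<in> C i \<or> v \<in> R" using 3 unfolding R_def by blast
      then show ?thesis
      proof
        assume "v \<in> C i"
        then show ?thesis using keep[OF 3(1)] 3(2) by simp
      next
        assume "v \<in> R"
        then show ?thesis using supp by blast
      qed
    \<comment> \<open>The remaining agents strictly prefer \<open>b\<close> in \<open>P\<close>, and
      \<open>improves\<close> demands nothing of them.\<close>
    qed simp
  qed
  with \<sigma> show ?thesis by (rule that)
qed

section \<open>Anonymous strategy-proof functions as up-sets of values of \<chi>\<close>

text \<open>If \<chi> grows from \<open>P\<close> to \<open>Q\<close>, some permutation of
  \<open>Q\<close> improves \<open>P\<close> and so has value \<open>a\<close>, and anonymity undoes
  the permutation. Conversely, improvements raise \<chi>, and permutations preserve it, so
  monotonicity in both directions gives anonymity.\<close>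

lemma anonymous_strategy_proof_iff:
  assumes \<phi>: "\<phi> \<in> profiles V \<W> \<rightarrow> {a, b}"
  shows "anonymous V \<W> \<phi> \<and> weakly_group_strategy_proof V \<W> \<phi> \<longleftrightarrow>
    (\<forall>P\<in>profiles V \<W>. \<forall>Q\<in>profiles V \<W>.
      (\<chi> V a b \<tau> W P, \<chi> V a b \<tau> W Q) \<in> L_order (card V) \<tau> \<longrightarrow> \<phi> P = a \<longrightarrow> \<phi> Q = a)"
    (is "_ \<longleftrightarrow> ?mono")
proof -
  have perm: "P \<circ> \<sigma> \<in> profiles V \<W>" if "P \<in> profiles V \<W>" "\<sigma> permutes V" for P \<sigma>
    using that permutes_in_image[OF that(2)]
    by (auto simp: profiles_def PiE_iff extensional_def)
  have *: "anonymous V \<W> \<phi>" if mono: ?mono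
    unfolding anonymous_def
  proof (intro ballI allI impI)
    fix P \<sigma> assume P: "P \<in> profiles V \<W>" and \<sigma>: "\<sigma> permutes V"
    have "(\<chi> V a b \<tau> W P, \<chi> V a b \<tau> W P) \<in> L_order (card V) \<tau>"
      by (simp add: \<chi>_le_iff)
    then have "\<phi> P = a \<longleftrightarrow> \<phi> (P \<circ> \<sigma>) = a"
      using mono P perm[OF P \<sigma>] \<chi>_permute[OF \<sigma>] by metis
    then show "\<phi> P = \<phi> (P \<circ> \<sigma>)" using funcset_mem[OF \<phi> P] funcset_mem[OF \<phi> perm[OF P \<sigma>]]
      by (metis insertE singletonD)
  qed
  show ?thesis
    unfolding weakly_group_strategy_proof_iff_improves[OF \<phi> a_neq_b]
  proof (intro iffI conjI)
    assume asm: "anonymous V \<W> \<phi> \<and> (\<forall>P\<in>profiles V \<W>. \<forall>Q\<in>profiles V \<W>.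
      improves V a b P Q \<longrightarrow> \<phi> P = a \<longrightarrow> \<phi> Q = a)"
    show ?mono
    proof (intro ballI impI)
      fix P Q
      assume P: "P \<in> profiles V \<W>" and Q: "Q \<in> profiles V \<W>" and a: "\<phi> P = a"
        and "(\<chi> V a b \<tau> W P, \<chi> V a b \<tau> W Q) \<in> L_order (card V) \<tau>"
      then obtain \<sigma> where \<sigma>: "\<sigma> permutes V" "improves V a b P (Q \<circ> \<sigma>)"
        using improves_permuted_if_\<chi>_le by blast
      then have "\<phi> (Q \<circ> \<sigma>) = a" using asm P a perm[OF Q \<sigma>(1)] by blast
      then show "\<phi> Q = a" using asm Q \<sigma>(1) by (simp add: anonymous_def)
    qed
  qed (use * \<chi>_le_if_improves in blast)+
qed

text \<open>The inverse takes \<phi> to the set of values of \<chi> at profiles where \<phi> is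
  \<open>a\<close>.\<close>

lemma bij_betw_up_sets_choice_functions:
  "bij_betw (\<lambda>U. \<lambda>P\<in>profiles V \<W>. if \<chi> V a b \<tau> W P \<in> U then a else b)
    {U. U \<subseteq> \<chi> V a b \<tau> W ` profiles V \<W> \<and>
       (\<forall>x\<in>U. \<forall>y\<in>\<chi> V a b \<tau> W ` profiles V \<W>. (x, y) \<in> L_order (card V) \<tau> \<longrightarrow> y \<in> U)}
    {\<phi> \<in> profiles V \<W> \<rightarrow>\<^sub>E {a, b}. anonymous V \<W> \<phi> \<and> weakly_group_strategy_proof V \<W> \<phi>}"
    (is "bij_betw ?F ?Us ?\<Phi>")
proof -
  let ?mono = "\<lambda>\<phi>. \<forall>P\<in>profiles V \<W>. \<forall>Q\<in>profiles V \<W>.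
      (\<chi> V a b \<tau> W P, \<chi> V a b \<tau> W Q) \<in> L_order (card V) \<tau> \<longrightarrow> \<phi> P = a \<longrightarrow> \<phi> Q = a"
  let ?G = "\<lambda>\<phi>. \<chi> V a b \<tau> W ` {P \<in> profiles V \<W>. \<phi> P = a}"
  have \<Phi>: "?\<Phi> = {\<phi> \<in> profiles V \<W> \<rightarrow>\<^sub>E {a, b}. ?mono \<phi>}"
    using anonymous_strategy_proof_iff by (intro Collect_cong conj_cong) (auto simp: PiE_iff)
  have refl: "(\<chi> V a b \<tau> W P, \<chi> V a b \<tau> W P) \<in> L_order (card V) \<tau>" for P
    by (simp add: \<chi>_le_iff)
  show ?thesis
    unfolding \<Phi>
  proof (rule bij_betw_byWitness[where f' = ?G])
    show "\<forall>U\<in>?Us. ?G (?F U) = U"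
    proof
      fix U assume U: "U \<in> ?Us"
      have "?F U P = a \<longleftrightarrow> \<chi> V a b \<tau> W P \<in> U" if "P \<in> profiles V \<W>" for P
        using that a_neq_b by simp
      then show "?G (?F U) = U" using U by blast
    qed
    show "\<forall>\<phi>\<in>{\<phi> \<in> profiles V \<W> \<rightarrow>\<^sub>E {a, b}. ?mono \<phi>}. ?F (?G \<phi>) = \<phi>"
    proof
      fix \<phi> assume "\<phi> \<in> {\<phi> \<in> profiles V \<W> \<rightarrow>\<^sub>E {a, b}. ?mono \<phi>}"
      then have \<phi>: "\<phi> \<in> profiles V \<W> \<rightarrow>\<^sub>E {a, b}" and mono: "?mono \<phi>" by auto
      \<comment> \<open>The value of \<chi> at \<open>P\<close> may come from another profile with
        outcome \<open>a\<close>; by reflexivity of the order, monotonicity carries \<open>a\<close>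
        over to \<open>P\<close>.\<close>
      have mem: "\<chi> V a b \<tau> W P \<in> ?G \<phi> \<longleftrightarrow> \<phi> P = a" if "P \<in> profiles V \<W>" for P
        using that mono refl by (smt (verit) image_iff mem_Collect_eq)
      show "?F (?G \<phi>) = \<phi>"
      proof
        fix P show "?F (?G \<phi>) P = \<phi> P"
          using mem[of P] \<phi> by (cases "P \<in> profiles V \<W>") (auto simp: PiE_iff extensional_def)
      qed
    qed
    show "?F ` ?Us \<subseteq> {\<phi> \<in> profiles V \<W> \<rightarrow>\<^sub>E {a, b}. ?mono \<phi>}"
    proof (rule image_subsetI)
      fix U assume U: "U \<in> ?Us"
      have "?F U P = a \<longleftrightarrow> \<chi> V a b \<tau> W P \<in> U" if "P \<in> profiles V \<W>" for P
        using that a_neq_b by simp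
      then have "?mono (?F U)" using U by blast
      moreover have "?F U \<in> profiles V \<W> \<rightarrow>\<^sub>E {a, b}" by auto
      ultimately show "?F U \<in> {\<phi> \<in> profiles V \<W> \<rightarrow>\<^sub>E {a, b}. ?mono \<phi>}" by blast
    qed
    show "?G ` {\<phi> \<in> profiles V \<W> \<rightarrow>\<^sub>E {a, b}. ?mono \<phi>} \<subseteq> ?Us"
      by blast
  qed
qed

end

section \<open>Composing the two bijections\<close>

theorem corollary4p4:
  fixes V :: "'v set" and A :: "'a set" and \<W> :: "'a rel set"
    and a b :: 'a and n \<tau> :: nat and W :: "nat \<Rightarrow> 'a rel"
  assumes "finite V" and "card V = n"
    and "a \<in> A" and "b \<in> A" and "a \<noteq> b"
    and "\<W> \<subseteq> preferences A"
    and "bij_betw W {1..\<tau>} {w \<in> \<W>. indifferent w a b}"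
  shows "bij_betw (\<phi>_antichain V \<W> a b \<tau> W)
           (antichains (\<chi> V a b \<tau> W ` profiles V \<W>) (L_order n \<tau>))
           {\<phi> \<in> profiles V \<W> \<rightarrow>\<^sub>E {a, b}.
              anonymous V \<W> \<phi> \<and> weakly_group_strategy_proof V \<W> \<phi>}"
proof -
  interpret two_alternatives V \<W> a b \<tau> W
  proof
    show "(a, b) \<in> w \<or> (b, a) \<in> w" if "w \<in> \<W>" for w
      using that assms(3,4,6) unfolding preferences_def by blast
  qed (fact assms)+
  let ?S = "\<chi> V a b \<tau> W ` profiles V \<W>"
  have S: "?S \<subseteq> L n \<tau>" by (rule image_subsetI) (rule \<chi>_in_L[OF assms(1), unfolded assms(2)])
  \<comment> \<open>There may be infinitely many profiles, but their values of \<chi> lie in a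
    finite set.\<close>
  moreover have "finite (L n \<tau>)" by (auto simp: L_def intro: finite_PiE)
  ultimately have "finite ?S" using finite_subset by blast
  from bij_betw_trans[OF bij_betw_antichains_up_sets[OF this S partial_order_L]
      bij_betw_up_sets_choice_functions[unfolded assms(2)]]
  show ?thesis
  proof (rule iffD1[OF bij_betw_cong, rotated])
    fix \<Delta>
    \<comment> \<open>Every profile has its value of \<chi> in \<open>?S\<close>, so lying in the
      up-set generated by \<open>\<Delta>\<close> is just the condition in
      \<open>\<phi>_antichain\<close>.\<close>
    show "((\<lambda>U. \<lambda>P\<in>profiles V \<W>. if \<chi> V a b \<tau> W P \<in> U then a else b) \<circ>
        (\<lambda>\<Delta>. {x \<in> ?S. \<exists>y\<in>\<Delta>. (y, x) \<in> L_order n \<tau>})) \<Delta> = \<phi>_antichain V \<W> a b \<tau> W \<Delta>"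
      unfolding \<phi>_antichain_def comp_def assms(2)
      by (rule restrict_ext) simp
  qed
qed

end
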